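(* Let $p\in[1,\infty)$, $L>0$, $\epsilon\ge0$, let $f:\mathcal{X}\to\mathcal{Y}$ be $L$-Lipschitz with respect to the $\ell_p$ norm, let $S\subseteq\Omega$ be nonempty, and let $(X,Y)\in\mathcal{X}\times\mathcal{K}^{|\Omega|}$. Put $c_\omega=R^\omega(X,Y)^p$ and $$N_{\mathrm{PA}}(X,\epsilon)=\max\Big\{\sum_{\omega\in S}p_\omega\;:\;p_\omega\in\{0,1\}\ (\omega\in S),\ \sum_{\omega\in S}L^p c_\omega p_\omega\le (L\epsilon)^p\Big\}.$$ Then $$N_{\mathrm{PA}}(X,\epsilon)=\max\Big\{n\in\{0,1,\dots,|S|\}\;:\;\sum_{k=1}^{n}R^{\pi_X(k)}(X,Y)^p\le\epsilon^p\Big\},$$ where $\pi_X:\{1,\dots,|S|\}\to S$ is a bijection sorting $S$ in ascending order of $R^\omega(X,Y)$, and the worst-case pixel accuracy on $S$ satisfies $$\min_{\tilde X\in\mathcal{B}_p^{\epsilon}(X)}\ \frac{1}{|S|}\sum_{\omega\in S}\mathbf{1}_{\tilde Y_\omega=Y_\omega}\;\ge\;1-\frac{N_{\mathrm{PA}}(X,\epsilon)}{|S|},$$ where $\tilde Y_\omega=\arg\max_{k\in\mathcal{K}}f^k(\tilde X)_\omega$.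
   Context: $\Omega$ is a finite nonempty set of coordinates (pixels), $\mathcal{K}$ is a finite set of classes with $|\mathcal{K}|\ge2$, $\mathcal{X}=[0,1]^{|\Omega|}$, $\mathcal{Y}=\mathbb{R}^{|\mathcal{K}|\times|\Omega|}$ with the entrywise $\ell_p$ norm. A function $f:\mathcal{X}\to\mathcal{Y}$ is $L$-Lipschitz in $\ell_p$ norm if $\|f(X_1)-f(X_2)\|_p\le L\|X_1-X_2\|_p$ for all $X_1,X_2\in\mathcal{X}$. $f^k(X)_\omega$ is the output for class $k$ at coordinate $\omega$. $\mathcal{B}_p^{\epsilon}(X)=\{\tilde X\in\mathcal{X}:\|\tilde X-X\|_p\le\epsilon\}$. The predicted class is $\hat Y_\omega=\arg\max_{k}f^k(X)_\omega$ (with any fixed tie-breaking rule). The margin $\mathcal{M}_X^\omega(f)=f^{\mathrm{top1}}(X)_\omega-f^{\mathrm{top2}}(X)_\omega\ge0$ is the difference between the largest and second largest (with multiplicity) of the values $f^k(X)_\omega$, $k\in\mathcal{K}$. The per-pixel robustness is $$R^\omega(X,Y)=\mathbf{1}_{\hat Y_\omega=Y_\omega}\cdot 2^{\frac{1-p}{p}}\cdot\mathcal{M}_X^\omega(f)/L .$$ *)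

theory Defs
  imports "HOL-Analysis.Analysis" "HOL-Library.Multiset"
begin

text \<open>
  Coordinates (pixels) are the elements of the finite type \<open>'w\<close>, classes those of the finite
  type \<open>'k\<close>. An output \<open>Z :: real ^ 'w ^ 'k\<close> is indexed as \<open>Z $ k $ w\<close>, class first. A function on
  the cube is a total function of which only the values on \<open>unit_cube\<close> are ever used.
\<close>

definition unit_cube :: "(real ^ 'w::finite) set" where
  "unit_cube = {X. \<forall>w. 0 \<le> X $ w \<and> X $ w \<le> 1}"

definition lp_norm_vec :: "real \<Rightarrow> real ^ 'w::finite \<Rightarrow> real" where
  "lp_norm_vec p X = (\<Sum>w\<in>UNIV. \<bar>X $ w\<bar> powr p) powr (1 / p)"

definition lp_norm_mat :: "real \<Rightarrow> real ^ 'w::finite ^ 'k::finite \<Rightarrow> real" where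
  "lp_norm_mat p Z = (\<Sum>k\<in>UNIV. \<Sum>w\<in>UNIV. \<bar>Z $ k $ w\<bar> powr p) powr (1 / p)"

definition lp_lipschitz ::
    "real \<Rightarrow> real \<Rightarrow> (real ^ 'w::finite \<Rightarrow> real ^ 'w ^ 'k::finite) \<Rightarrow> bool" where
  "lp_lipschitz p L f \<longleftrightarrow>
     (\<forall>X1\<in>unit_cube. \<forall>X2\<in>unit_cube.
        lp_norm_mat p (f X1 - f X2) \<le> L * lp_norm_vec p (X1 - X2))"

definition lp_ball :: "real \<Rightarrow> real \<Rightarrow> real ^ 'w::finite \<Rightarrow> (real ^ 'w) set" where
  "lp_ball p \<epsilon> X = {X' \<in> unit_cube. lp_norm_vec p (X' - X) \<le> \<epsilon>}"

definition class_scores ::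
    "(real ^ 'w::finite \<Rightarrow> real ^ 'w ^ 'k::finite) \<Rightarrow> real ^ 'w \<Rightarrow> 'w \<Rightarrow> 'k \<Rightarrow> real" where
  "class_scores f X w = (\<lambda>k. f X $ k $ w)"

text \<open>
  An argmax with a fixed tie-breaking rule is a function \<open>am\<close> selecting, for every vector of class
  scores, one of its maximizers.
\<close>

definition argmax_rule :: "(('k::finite \<Rightarrow> real) \<Rightarrow> 'k) \<Rightarrow> bool" where
  "argmax_rule am \<longleftrightarrow> (\<forall>v. is_arg_max v (\<lambda>k. True) (am v))"

definition predicted_class ::
    "(('k::finite \<Rightarrow> real) \<Rightarrow> 'k) \<Rightarrow> (real ^ 'w::finite \<Rightarrow> real ^ 'w ^ 'k) \<Rightarrow> real ^ 'w \<Rightarrow> 'w \<Rightarrow> 'k" where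
  "predicted_class am f X w = am (class_scores f X w)"

definition score_mset :: "('k::finite \<Rightarrow> real) \<Rightarrow> real multiset" where
  "score_mset v = image_mset v (mset_set UNIV)"

definition top1 :: "('k::finite \<Rightarrow> real) \<Rightarrow> real" where
  "top1 v = Max_mset (score_mset v)"

text \<open>
  Only one copy of the largest score is removed, so that \<open>top2 v = top1 v\<close> when the maximum is
  attained twice; the remaining multiset is nonempty as soon as there are two classes.
\<close>

definition top2 :: "('k::finite \<Rightarrow> real) \<Rightarrow> real" where
  "top2 v = Max_mset (score_mset v - {# top1 v #})"

definition margin ::
    "(real ^ 'w::finite \<Rightarrow> real ^ 'w ^ 'k::finite) \<Rightarrow> real ^ 'w \<Rightarrow> 'w \<Rightarrow> real" where
  "margin f X w = top1 (class_scores f X w) - top2 (class_scores f X w)"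

definition pixel_robustness ::
    "real \<Rightarrow> real \<Rightarrow> (('k::finite \<Rightarrow> real) \<Rightarrow> 'k) \<Rightarrow> (real ^ 'w::finite \<Rightarrow> real ^ 'w ^ 'k)
      \<Rightarrow> real ^ 'w \<Rightarrow> 'k ^ 'w \<Rightarrow> 'w \<Rightarrow> real" where
  "pixel_robustness p L am f X Y w =
     of_bool (predicted_class am f X w = Y $ w) * 2 powr ((1 - p) / p) * margin f X w / L"

text \<open>
  The optimal value of the 0-1 knapsack problem over \<open>S\<close>; the decision variable \<open>q\<close> is constrained
  and used on \<open>S\<close> only, so the set of attained values is finite.
\<close>

definition N_PA ::
    "real \<Rightarrow> real \<Rightarrow> real \<Rightarrow> (('k::finite \<Rightarrow> real) \<Rightarrow> 'k) \<Rightarrow> (real ^ 'w::finite \<Rightarrow> real ^ 'w ^ 'k)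
      \<Rightarrow> 'w set \<Rightarrow> real ^ 'w \<Rightarrow> 'k ^ 'w \<Rightarrow> nat" where
  "N_PA p L \<epsilon> am f S X Y =
     Max {\<Sum>w\<in>S. q w | q :: 'w \<Rightarrow> nat.
            (\<forall>w\<in>S. q w \<in> {0, 1}) \<and>
            (\<Sum>w\<in>S. L powr p * pixel_robustness p L am f X Y w powr p * real (q w))
              \<le> (L * \<epsilon>) powr p}"

definition sorts_ascending :: "('w \<Rightarrow> real) \<Rightarrow> 'w set \<Rightarrow> (nat \<Rightarrow> 'w) \<Rightarrow> bool" where
  "sorts_ascending r S \<pi> \<longleftrightarrow>
     bij_betw \<pi> {1..card S} S \<and> mono_on {1..card S} (\<lambda>i. r (\<pi> i))"

definition pixel_accuracy ::
    "(('k::finite \<Rightarrow> real) \<Rightarrow> 'k) \<Rightarrow> (real ^ 'w::finite \<Rightarrow> real ^ 'w ^ 'k)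
      \<Rightarrow> 'w set \<Rightarrow> 'k ^ 'w \<Rightarrow> real ^ 'w \<Rightarrow> real" where
  "pixel_accuracy am f S Y X =
     1 / real (card S) * (\<Sum>w\<in>S. of_bool (predicted_class am f X w = Y $ w))"

end

(* A perturbation that flips the correctly classified pixel w lowers the leading score and raises a
   competing one by at least the margin in total, so by convexity of t powr p the p-th power of the
   output change at w is at least (L * R w) powr p. Summing over all flipped pixels, the Lipschitz
   bound shows that they form a feasible point of the knapsack problem. All items of the knapsack
   have the same value, so taking the cheapest ones first is optimal. *)

theory Submission
  imports Defs
begin

section \<open>Knapsack with items of equal value\<close>

text \<open>Induction on \<open>card T\<close>, deleting the largest element: \<open>T\<close>
  consists of positive integers, so \<open>Max T\<close> is at least \<open>card T\<close>, and
  monotonicity bounds the last term of the initial sum by \<open>g (Max T)\<close>.\<close>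

lemma sum_initial_le_sum_subset:
  fixes g :: "nat \<Rightarrow> 'a::ordered_comm_monoid_add"
  assumes "T \<subseteq> {1..N}" and "mono_on {1..N} g"
  shows "(\<Sum>k = 1..card T. g k) \<le> sum g T"
  using assms(1)
proof (induction "card T" arbitrary: T)
  case 0
  then have "T = {}"
    by (metis card_0_eq finite_atLeastAtMost finite_subset)
  then show ?case by simp
next
  case (Suc n)
  have fin: "finite T" using Suc.prems finite_subset by blast
  have ne: "T \<noteq> {}" using Suc.hyps(2) by auto
  let ?m = "Max T"
  have mT: "?m \<in> T" using fin ne by simp
  have "T \<subseteq> {1..?m}" using fin Suc.prems by auto
  then have "card T \<le> card {1..?m}" by (intro card_mono) auto
  then have le: "Suc n \<le> ?m" using Suc.hyps(2) by simp
  have card': "n = card (T - {?m})" using Suc.hyps(2) fin mT by simp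
  have "(\<Sum>k = 1..n. g k) \<le> sum g (T - {?m})"
    using Suc.hyps(1)[OF card'] Suc.prems card' by auto
  moreover have "g (Suc n) \<le> g ?m"
    using mT Suc.prems le by (intro mono_onD[OF assms(2)]) auto
  ultimately have "(\<Sum>k = 1..n. g k) + g (Suc n) \<le> sum g (T - {?m}) + g ?m"
    by (rule add_mono)
  also have "\<dots> = sum g T" using fin mT by (simp add: sum.remove add.commute)
  finally show ?case by (simp flip: Suc.hyps(2))
qed

text \<open>A 0-1 vector \<open>q\<close> is the indicator of the subset of \<open>S\<close> where
  it equals 1; afterwards feasible points are sets of pixels.\<close>

lemma binary_knapsack_values:
  fixes c :: "'w \<Rightarrow> real"
  assumes "finite S"
  shows "{\<Sum>w\<in>S. q w | q :: 'w \<Rightarrow> nat.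
            (\<forall>w\<in>S. q w \<in> {0, 1}) \<and> (\<Sum>w\<in>S. c w * real (q w)) \<le> b}
       = {card D | D. D \<subseteq> S \<and> sum c D \<le> b}" (is "?A = ?B")
proof (intro equalityI subsetI)
  fix n assume "n \<in> ?A"
  then obtain q :: "'w \<Rightarrow> nat" where q: "n = (\<Sum>w\<in>S. q w)" "\<forall>w\<in>S. q w \<in> {0, 1}"
    "(\<Sum>w\<in>S. c w * real (q w)) \<le> b" by blast
  let ?D = "{w \<in> S. q w = 1}"
  have "(\<Sum>w\<in>S. q w) = (\<Sum>w\<in>S. if q w = 1 then 1 else 0)"
    using q(2) by (intro sum.cong) auto
  then have "n = card ?D"
    using q(1) assms by (simp add: sum.inter_filter[symmetric])
  moreover have "(\<Sum>w\<in>S. c w * real (q w)) = (\<Sum>w\<in>S. if q w = 1 then c w else 0)"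
    using q(2) by (intro sum.cong) auto
  then have "sum c ?D \<le> b" using q(3) assms by (simp add: sum.inter_filter)
  ultimately show "n \<in> ?B" by blast
next
  fix n assume "n \<in> ?B"
  then obtain D where D: "n = card D" "D \<subseteq> S" "sum c D \<le> b" by blast
  let ?q = "\<lambda>w. of_bool (w \<in> D) :: nat"
  have SD: "S \<inter> D = D" using D(2) by blast
  have "n = (\<Sum>w\<in>S. ?q w)" using D assms SD by (simp add: sum_of_bool_eq)
  moreover have "(\<Sum>w\<in>S. c w * real (?q w)) = (\<Sum>w\<in>S. if w \<in> D then c w else 0)"
    by (intro sum.cong) auto
  then have "(\<Sum>w\<in>S. c w * real (?q w)) \<le> b"
    using D(3) SD assms by (simp add: sum.inter_restrict[symmetric])
  ultimately show "n \<in> ?A" by (intro CollectI exI[of _ ?q]) auto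
qed

text \<open>Exchange argument: a feasible set of \<open>n\<close> items can be traded for the
  \<open>n\<close> cheapest ones at no higher cost. The two sets of attained values agree, so their
  maxima do too.\<close>

lemma equal_value_knapsack_greedy:
  fixes c :: "'w \<Rightarrow> real"
  assumes "bij_betw \<pi> {1..card S} S" and "mono_on {1..card S} (\<lambda>i. c (\<pi> i))"
  shows "{card D | D. D \<subseteq> S \<and> sum c D \<le> b}
       = {n \<in> {0..card S}. (\<Sum>k = 1..n. c (\<pi> k)) \<le> b}" (is "?A = ?B")
proof (intro equalityI subsetI)
  have fin: "finite S" using assms(1) bij_betw_finite by blast
  fix n assume "n \<in> ?A"
  then obtain D where D: "n = card D" "D \<subseteq> S" "sum c D \<le> b" by blast
  \<comment> \<open>The positions of the items of \<open>D\<close> in the sorted order, so that the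
    comparison takes place among indices.\<close>
  define T where "T = {i \<in> {1..card S}. \<pi> i \<in> D}"
  have bij: "bij_betw \<pi> T D"
  proof (rule bij_betw_subset[OF assms(1)])
    show "T \<subseteq> {1..card S}" by (auto simp: T_def)
    have "D \<subseteq> \<pi> ` {1..card S}" using assms(1) D(2) by (simp add: bij_betw_def)
    then show "\<pi> ` T = D" unfolding T_def by auto
  qed
  have "(\<Sum>k = 1..card T. c (\<pi> k)) \<le> (\<Sum>k\<in>T. c (\<pi> k))"
    using assms(2) by (intro sum_initial_le_sum_subset[where N = "card S"]) (auto simp: T_def)
  also have "\<dots> = sum c D" using bij by (rule sum.reindex_bij_betw)
  finally show "n \<in> ?B"
    using D bij_betw_same_card[OF bij] card_mono[OF fin D(2)] by auto
next
  fix n assume n: "n \<in> ?B"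
  \<comment> \<open>Injectivity makes the \<open>n\<close> cheapest items a set of exactly
    \<open>n\<close> elements.\<close>
  have inj: "inj_on \<pi> {1..n}"
    using assms(1) n by (auto simp: bij_betw_def intro: inj_on_subset)
  have "\<pi> ` {1..n} \<subseteq> S" using assms(1) n by (auto simp: bij_betw_def)
  moreover have "card (\<pi> ` {1..n}) = n" using inj by (simp add: card_image)
  moreover have "sum c (\<pi> ` {1..n}) \<le> b" using n inj by (simp add: sum.reindex)
  ultimately show "n \<in> ?A" by (intro CollectI exI[of _ "\<pi> ` {1..n}"]) auto
qed

section \<open>The two largest scores\<close>

lemma top1_eq:
  fixes v :: "'k::finite \<Rightarrow> real"
  assumes "is_arg_max v (\<lambda>k. True) a"
  shows "top1 v = v a"
  using assms unfolding top1_def score_mset_def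
  by (intro Max_eqI) (auto simp: is_arg_max_linorder)

text \<open>Removing one copy of \<open>top1 v\<close> deletes the index \<open>a\<close> alone. A
  maximizer tied with \<open>a\<close> survives, so any choice of \<open>a\<close> gives the same
  value.\<close>

lemma top2_eq:
  fixes v :: "'k::finite \<Rightarrow> real"
  assumes "is_arg_max v (\<lambda>k. True) a"
  shows "top2 v = Max (v ` (UNIV - {a}))"
proof -
  have "score_mset v = add_mset (v a) (image_mset v (mset_set (UNIV - {a})))"
    unfolding score_mset_def using mset_set.remove[of UNIV a] by simp
  then show ?thesis unfolding top2_def top1_eq[OF assms] by simp
qed

lemma top2_ge:
  fixes v :: "'k::finite \<Rightarrow> real"
  assumes "is_arg_max v (\<lambda>k. True) a" and "b \<noteq> a"
  shows "v b \<le> top2 v"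
  unfolding top2_eq[OF assms(1)] using assms(2) by (intro Max_ge) auto

lemma ex_is_arg_max:
  fixes v :: "'k::finite \<Rightarrow> real"
  shows "\<exists>a. is_arg_max v (\<lambda>k. True) a"
proof -
  have "Max (range v) \<in> range v" by (intro Max_in) auto
  then obtain a where a: "v a = Max (range v)" by (metis imageE)
  then show ?thesis by (auto simp: is_arg_max_linorder intro!: exI[of _ a])
qed

lemma top2_le_top1:
  fixes v :: "'k::finite \<Rightarrow> real"
  assumes "CARD('k) \<ge> 2"
  shows "top2 v \<le> top1 v"
proof -
  obtain a where a: "is_arg_max v (\<lambda>k. True) a" using ex_is_arg_max by blast
  have "UNIV - {a} \<noteq> {}"
  proof
    assume "UNIV - {a} = {}"
    then have "(UNIV :: 'k set) = {a}" by blast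
    then have "CARD('k) = card {a}" by (rule arg_cong)
    with assms show False by simp
  qed
  then show ?thesis
    unfolding top2_eq[OF a] top1_eq[OF a] using a by (subst Max_le_iff) (auto simp: is_arg_max_linorder)
qed

section \<open>The cost of flipping one pixel\<close>

lemma pixel_robustness_nonneg:
  fixes f :: "real ^ 'w::finite \<Rightarrow> real ^ 'w ^ 'k::finite"
  assumes "CARD('k) \<ge> 2" and "L > 0"
  shows "pixel_robustness p L am f X Y w \<ge> 0"
  using assms top2_le_top1[OF assms(1)] by (simp add: pixel_robustness_def margin_def)

text \<open>Convexity of \<open>t powr p\<close> at the midpoint of \<open>x\<close> and
  \<open>y\<close>; the constant is \<open>2 powr p / 2\<close>.\<close>

lemma powr_add_le_two_powr:
  fixes x y p :: real
  assumes "1 \<le> p" and "0 \<le> x" and "0 \<le> y"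
  shows "(x + y) powr p \<le> 2 powr (p - 1) * (x powr p + y powr p)"
\<comment> \<open>Convexity is used on the open half-line only. If a summand vanishes,
  \<open>2 powr (p - 1) \<ge> 1\<close> suffices.\<close>
proof (cases "x = 0 \<or> y = 0")
  case True
  have "z powr p \<le> 2 powr (p - 1) * z powr p" for z :: real
    using assms(1) mult_right_mono[of 1 "2 powr (p - 1)" "z powr p"] ge_one_powr_ge_zero[of 2 "p - 1"] by simp
  then show ?thesis using True by auto
next
  case False
  then have pos: "x > 0" "y > 0" using assms by auto
  have "convex_on {0<..} (\<lambda>t::real. t powr p)" using assms(1) by (rule powr_convex)
  from convex_onD[OF this, of "1/2" x y] pos
  have half: "((x + y) / 2) powr p \<le> (x powr p + y powr p) / 2"
    by (simp add: add_divide_distrib)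
  have "(x + y) powr p = 2 powr p * ((x + y) / 2) powr p"
    using pos by (simp add: powr_divide)
  also have "\<dots> \<le> 2 powr p * ((x powr p + y powr p) / 2)"
    using half by (intro mult_left_mono) auto
  also have "\<dots> = 2 powr (p - 1) * (x powr p + y powr p)"
    by (simp add: powr_diff)
  finally show ?thesis .
qed

lemma margin_powr_le_sum_change:
  fixes u v :: "'k::finite \<Rightarrow> real"
  assumes "CARD('k) \<ge> 2" and "1 \<le> p"
    and a: "is_arg_max u (\<lambda>k. True) a" and b: "is_arg_max v (\<lambda>k. True) b" and "a \<noteq> b"
  shows "2 powr (1 - p) * (top1 u - top2 u) powr p \<le> (\<Sum>k\<in>UNIV. \<bar>v k - u k\<bar> powr p)"
proof -
  have "u b \<le> top2 u" using a \<open>a \<noteq> b\<close> by (intro top2_ge) auto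
  moreover have "v a \<le> v b" using b by (auto simp: is_arg_max_linorder)
  \<comment> \<open>\<open>u a - u b\<close> is at least the margin and \<open>v b - v a\<close> is
    nonnegative; their sum is the drop at \<open>a\<close> plus the rise at
    \<open>b\<close>.\<close>
  ultimately have "top1 u - top2 u \<le> \<bar>v a - u a\<bar> + \<bar>v b - u b\<bar>"
    unfolding top1_eq[OF a] by linarith
  then have "(top1 u - top2 u) powr p \<le> (\<bar>v a - u a\<bar> + \<bar>v b - u b\<bar>) powr p"
    using top2_le_top1[OF assms(1), of u] assms(2) by (intro powr_mono2) auto
  also have "\<dots> \<le> 2 powr (p - 1) * (\<bar>v a - u a\<bar> powr p + \<bar>v b - u b\<bar> powr p)"
    using assms(2) by (intro powr_add_le_two_powr) auto
  finally have "2 powr (1 - p) * (top1 u - top2 u) powr p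
      \<le> 2 powr (1 - p) * (2 powr (p - 1) * (\<bar>v a - u a\<bar> powr p + \<bar>v b - u b\<bar> powr p))"
    by (intro mult_left_mono) auto
  \<comment> \<open>The two powers of 2 cancel, and \<open>a \<noteq> b\<close> keeps both terms in
    the sum.\<close>
  also have "\<dots> = (\<Sum>k\<in>{a, b}. \<bar>v k - u k\<bar> powr p)"
    using \<open>a \<noteq> b\<close> by (simp add: mult.assoc[symmetric] powr_add[symmetric])
  also have "\<dots> \<le> (\<Sum>k\<in>UNIV. \<bar>v k - u k\<bar> powr p)"
    by (intro sum_mono2) auto
  finally show ?thesis .
qed

text \<open>The factor \<open>2 powr ((1 - p) / p)\<close> in the robustness is the one whose
  \<open>p\<close>-th power is the constant \<open>2 powr (1 - p)\<close> of the margin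
  bound.\<close>

lemma pixel_robustness_powr_le:
  fixes f :: "real ^ 'w::finite \<Rightarrow> real ^ 'w ^ 'k::finite"
  assumes "CARD('k) \<ge> 2" and "1 \<le> p" and "L > 0" and am: "argmax_rule am"
    and "predicted_class am f X' w \<noteq> Y $ w"
  shows "L powr p * pixel_robustness p L am f X Y w powr p
       \<le> (\<Sum>k\<in>UNIV. \<bar>(f X' - f X) $ k $ w\<bar> powr p)"
proof (cases "predicted_class am f X w = Y $ w")
  \<comment> \<open>A pixel already misclassified at \<open>X\<close> has robustness 0, and
    \<open>0 powr p = 0\<close>: it costs nothing.\<close>
  case False
  then show ?thesis by (simp add: pixel_robustness_def sum_nonneg)
next
  case True
  let ?u = "class_scores f X w" and ?v = "class_scores f X' w"
  have m: "margin f X w \<ge> 0" unfolding margin_def using top2_le_top1[OF assms(1)] by simp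
  have "L powr p * pixel_robustness p L am f X Y w powr p
      = (2 powr ((1 - p) / p) * margin f X w) powr p"
    using True m \<open>L > 0\<close> by (simp add: pixel_robustness_def powr_divide)
  also have "\<dots> = 2 powr (1 - p) * margin f X w powr p"
    using m assms(2) by (simp add: powr_mult powr_powr)
  also have "\<dots> \<le> (\<Sum>k\<in>UNIV. \<bar>?v k - ?u k\<bar> powr p)"
    unfolding margin_def
  proof (rule margin_powr_le_sum_change)
    show "is_arg_max ?u (\<lambda>k. True) (am ?u)" "is_arg_max ?v (\<lambda>k. True) (am ?v)"
      using am by (auto simp: argmax_rule_def)
    show "am ?u \<noteq> am ?v" using True assms(5) by (simp add: predicted_class_def)
  qed (use assms in auto)
  finally show ?thesis by (simp add: class_scores_def)
qed

section \<open>The Lipschitz budget shared by all pixels\<close>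

lemma lp_lipschitz_powr:
  fixes f :: "real ^ 'w::finite \<Rightarrow> real ^ 'w ^ 'k::finite"
  assumes "1 \<le> p" and "L > 0" and "lp_lipschitz p L f"
    and "X \<in> unit_cube" and "X' \<in> lp_ball p \<epsilon> X"
  shows "(\<Sum>k\<in>UNIV. \<Sum>w\<in>UNIV. \<bar>(f X' - f X) $ k $ w\<bar> powr p) \<le> (L * \<epsilon>) powr p"
proof -
  let ?s = "\<Sum>k\<in>UNIV. \<Sum>w\<in>UNIV. \<bar>(f X' - f X) $ k $ w\<bar> powr p"
  have s: "?s \<ge> 0" by (intro sum_nonneg) auto
  have "?s powr (1 / p) \<le> L * lp_norm_vec p (X' - X)"
    using assms by (auto simp: lp_lipschitz_def lp_norm_mat_def lp_ball_def)
  also have "\<dots> \<le> L * \<epsilon>"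
    using assms by (intro mult_left_mono) (auto simp: lp_ball_def)
  finally have "(?s powr (1 / p)) powr p \<le> (L * \<epsilon>) powr p"
    using assms(1) by (intro powr_mono2) auto
  then show ?thesis using s assms(1) by (simp add: powr_powr)
qed

text \<open>Different pixels use disjoint entries of the output, so the single-pixel costs add up
  within one global budget.\<close>

lemma misclassified_feasible:
  fixes f :: "real ^ 'w::finite \<Rightarrow> real ^ 'w ^ 'k::finite"
  assumes "CARD('k) \<ge> 2" and "1 \<le> p" and "L > 0" and "lp_lipschitz p L f"
    and "argmax_rule am" and "X \<in> unit_cube" and "X' \<in> lp_ball p \<epsilon> X"
    and D: "\<And>w. w \<in> D \<Longrightarrow> predicted_class am f X' w \<noteq> Y $ w"
  shows "(\<Sum>w\<in>D. L powr p * pixel_robustness p L am f X Y w powr p) \<le> (L * \<epsilon>) powr p"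
proof -
  have "(\<Sum>w\<in>D. L powr p * pixel_robustness p L am f X Y w powr p)
      \<le> (\<Sum>w\<in>D. \<Sum>k\<in>UNIV. \<bar>(f X' - f X) $ k $ w\<bar> powr p)"
    using assms by (intro sum_mono pixel_robustness_powr_le) auto
  also have "\<dots> \<le> (\<Sum>w\<in>UNIV. \<Sum>k\<in>UNIV. \<bar>(f X' - f X) $ k $ w\<bar> powr p)"
    by (intro sum_mono2) (auto intro: sum_nonneg)
  also have "\<dots> = (\<Sum>k\<in>UNIV. \<Sum>w\<in>UNIV. \<bar>(f X' - f X) $ k $ w\<bar> powr p)"
    by (rule sum.swap)
  also have "\<dots> \<le> (L * \<epsilon>) powr p" using assms by (intro lp_lipschitz_powr)
  finally show ?thesis .
qed

section \<open>From the knapsack to the accuracy bound\<close>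

lemma pixel_accuracy_eq:
  assumes "S \<noteq> {}"
  shows "pixel_accuracy am f S Y X =
    1 - real (card {w \<in> S. predicted_class am f X w \<noteq> Y $ w}) / real (card S)"
proof -
  let ?C = "{w \<in> S. predicted_class am f X w = Y $ w}"
  let ?D = "{w \<in> S. predicted_class am f X w \<noteq> Y $ w}"
  have pos: "card S > 0" using assms by (simp add: card_gt_0_iff)
  have "S = ?C \<union> ?D" by blast
  then have "card S = card (?C \<union> ?D)" by (rule arg_cong)
  also have "\<dots> = card ?C + card ?D" by (intro card_Un_disjoint) auto
  finally have "real (card ?C) = real (card S) - real (card ?D)" by simp
  moreover have "S \<inter> {w. predicted_class am f X w = Y $ w} = ?C" by blast
  ultimately show ?thesis
    using pos assms by (simp add: pixel_accuracy_def sum_of_bool_eq diff_divide_distrib)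
qed

lemma N_PA_eq:
  fixes f :: "real ^ 'w::finite \<Rightarrow> real ^ 'w ^ 'k::finite"
  shows "N_PA p L \<epsilon> am f S X Y = Max {card D | D. D \<subseteq> S \<and>
      (\<Sum>w\<in>D. L powr p * pixel_robustness p L am f X Y w powr p) \<le> (L * \<epsilon>) powr p}"
  unfolding N_PA_def by (subst binary_knapsack_values) auto

theorem mainTheorem2:
  fixes f :: "real ^ 'w::finite \<Rightarrow> real ^ 'w ^ 'k::finite"
    and p L \<epsilon> :: real
    and S :: "'w set"
    and X :: "real ^ 'w"
    and Y :: "'k ^ 'w"
    and am :: "('k \<Rightarrow> real) \<Rightarrow> 'k"
  assumes "CARD('k) \<ge> 2"
    and "1 \<le> p" and "L > 0" and "\<epsilon> \<ge> 0"
    and "lp_lipschitz p L f"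
    and "argmax_rule am"
    and "S \<noteq> {}"
    and "X \<in> unit_cube"
  shows "(\<forall>\<pi>. sorts_ascending (pixel_robustness p L am f X Y) S \<pi> \<longrightarrow>
            N_PA p L \<epsilon> am f S X Y =
              Max {n \<in> {0..card S}.
                     (\<Sum>k = 1..n. pixel_robustness p L am f X Y (\<pi> k) powr p) \<le> \<epsilon> powr p})
       \<and> Min (pixel_accuracy am f S Y ` lp_ball p \<epsilon> X)
           \<ge> 1 - real (N_PA p L \<epsilon> am f S X Y) / real (card S)"
proof (intro conjI allI impI)
  let ?R = "pixel_robustness p L am f X Y"
  fix \<pi> assume "sorts_ascending ?R S \<pi>"
  then have bij: "bij_betw \<pi> {1..card S} S" and mono: "mono_on {1..card S} (\<lambda>i. ?R (\<pi> i))"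
    by (auto simp: sorts_ascending_def)
  \<comment> \<open>The weights are \<open>p\<close>-th powers; since the robustness is nonnegative,
    sorting by it also sorts the weights.\<close>
  have "mono_on {1..card S} (\<lambda>i. ?R (\<pi> i) powr p)"
    using mono \<open>1 \<le> p\<close> pixel_robustness_nonneg[OF \<open>CARD('k) \<ge> 2\<close> \<open>L > 0\<close>]
    by (auto simp: mono_on_def intro!: powr_mono2)
  from equal_value_knapsack_greedy[OF bij this, of "\<epsilon> powr p"]
  have "{card D | D. D \<subseteq> S \<and> (\<Sum>w\<in>D. ?R w powr p) \<le> \<epsilon> powr p}
      = {n \<in> {0..card S}. (\<Sum>k = 1..n. ?R (\<pi> k) powr p) \<le> \<epsilon> powr p}" .
  moreover have "(\<Sum>w\<in>D. L powr p * ?R w powr p) \<le> (L * \<epsilon>) powr p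
      \<longleftrightarrow> (\<Sum>w\<in>D. ?R w powr p) \<le> \<epsilon> powr p" for D
    using \<open>L > 0\<close> \<open>\<epsilon> \<ge> 0\<close> by (simp add: powr_mult flip: sum_distrib_left)
  ultimately show "N_PA p L \<epsilon> am f S X Y =
      Max {n \<in> {0..card S}. (\<Sum>k = 1..n. ?R (\<pi> k) powr p) \<le> \<epsilon> powr p}"
    unfolding N_PA_eq by simp
next
  let ?bad = "\<lambda>X'. {w \<in> S. predicted_class am f X' w \<noteq> Y $ w}"
  \<comment> \<open>Nonemptiness and finiteness are what \<open>Min_ge_iff\<close> asks for.\<close>
  have "X \<in> lp_ball p \<epsilon> X"
    using assms by (simp add: lp_ball_def lp_norm_vec_def)
  then have ne: "pixel_accuracy am f S Y ` lp_ball p \<epsilon> X \<noteq> {}" by blast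
  \<comment> \<open>The ball may be infinite, but the accuracy depends only on which subset of
    \<open>S\<close> is misclassified.\<close>
  have "pixel_accuracy am f S Y ` lp_ball p \<epsilon> X
      \<subseteq> (\<lambda>D. 1 - real (card D) / real (card S)) ` Pow S"
    using pixel_accuracy_eq[OF \<open>S \<noteq> {}\<close>, of am f Y] by auto
  then have fin: "finite (pixel_accuracy am f S Y ` lp_ball p \<epsilon> X)"
    by (rule finite_subset) simp
  have "1 - real (N_PA p L \<epsilon> am f S X Y) / real (card S) \<le> pixel_accuracy am f S Y X'"
    if X': "X' \<in> lp_ball p \<epsilon> X" for X'
  proof -
    have "card (?bad X') \<le> N_PA p L \<epsilon> am f S X Y"
      unfolding N_PA_eq
    proof (rule Max_ge)
      let ?F = "{D. D \<subseteq> S \<and>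
        (\<Sum>w\<in>D. L powr p * pixel_robustness p L am f X Y w powr p) \<le> (L * \<epsilon>) powr p}"
      have "finite (card ` ?F)" by simp
      then show "finite {card D | D. D \<subseteq> S \<and>
        (\<Sum>w\<in>D. L powr p * pixel_robustness p L am f X Y w powr p) \<le> (L * \<epsilon>) powr p}"
        by (simp add: image_Collect)
      \<comment> \<open>The pixels misclassified at \<open>X'\<close> form a feasible set, so their
        number is among the values maximized.\<close>
      have "(\<Sum>w\<in>?bad X'. L powr p * pixel_robustness p L am f X Y w powr p) \<le> (L * \<epsilon>) powr p"
        using assms X' by (intro misclassified_feasible) auto
      then show "card (?bad X') \<in> {card D | D. D \<subseteq> S \<and>
        (\<Sum>w\<in>D. L powr p * pixel_robustness p L am f X Y w powr p) \<le> (L * \<epsilon>) powr p}"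
        by blast
    qed
    then show ?thesis
      unfolding pixel_accuracy_eq[OF \<open>S \<noteq> {}\<close>] by (simp add: divide_right_mono)
  qed
  then show "Min (pixel_accuracy am f S Y ` lp_ball p \<epsilon> X)
      \<ge> 1 - real (N_PA p L \<epsilon> am f S X Y) / real (card S)"
    using ne fin by (subst Min_ge_iff) auto
qed

end
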